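(* For all integers $n\ge 1$ and $m$ with $1\le m\le n$, $$\sum_{k=0}^{n-m}\frac{n\binom{k+m-1}{k}}{n+k}\,B_k^{(n+k)}\,S_2(n,k+m)=\delta_{m,n},$$ where $\delta_{m,n}$ is the Kronecker symbol.
   Context: For an integer $r\ge 0$, the Bernoulli numbers of order $r$, $B_k^{(r)}$, are defined by $\left(\frac{t}{e^t-1}\right)^r=\sum_{k=0}^{\infty}B_k^{(r)}\frac{t^k}{k!}$. $S_2(n,k)$ denotes the Stirling numbers of the second kind. *)

theory Defs
  imports
    "HOL-Computational_Algebra.Formal_Power_Series"
    "HOL-Combinatorics.Stirling"
begin

(* Division of formal power series cancels the common factor t here: numerator and
   denominator both have subdegree 1; see bernoulli_base_mult. *)
definition bernoulli_order :: "nat \<Rightarrow> nat \<Rightarrow> rat" where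
  "bernoulli_order r k = fact k * fps_nth ((fps_X / (fps_exp 1 - 1)) ^ r) k"

lemma bernoulli_base_mult: "fps_X / (fps_exp 1 - 1) * (fps_exp 1 - 1) = (fps_X :: rat fps)"
proof -
  have "fps_nth (fps_exp 1 - 1 :: rat fps) 1 \<noteq> 0" by simp
  then have nz: "fps_exp 1 - 1 \<noteq> (0 :: rat fps)" and
    "subdegree (fps_exp 1 - 1 :: rat fps) \<le> 1"
    by (force, rule subdegree_leI)
  then have "fps_exp 1 - 1 dvd (fps_X :: rat fps)"
    by (simp add: fps_dvd_iff)
  then show ?thesis by (rule dvd_div_mult_self)
qed

lemma bernoulli_order_egf:
  "(fps_X / (fps_exp 1 - 1)) ^ r = Abs_fps (\<lambda>k. bernoulli_order r k / fact k)"
  by (simp add: bernoulli_order_def fps_eq_iff)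

end

theory Submission
  imports Defs
begin

unbundle fps_syntax

text \<open>Let \<open>f = e\<^sup>t - 1\<close>, with compositional inverse \<open>g\<close>. Lagrange inversion turns
  \<open>n/(n+k) B\<^sub>k\<^bsup>(n+k)\<^esup>/k!\<close> into the coefficient of \<open>u\<^bsup>n+k\<^esup>\<close> in \<open>g\<^sup>n\<close>, that is, of \<open>u\<^sup>k\<close> in
  \<open>(g/u)\<^sup>n\<close>. Since \<open>j!/n! S\<^sub>2(n,j)\<close> is the coefficient of \<open>t\<^sup>n\<close> in \<open>f\<^sup>j\<close>, Lagrange inversion with
  the roles of \<open>f\<close> and \<open>g\<close> exchanged expresses it by the coefficient of \<open>u\<^bsup>n-j\<^esup>\<close> in \<open>(u/g)\<^sup>n\<close>.
  The binomial coefficient absorbs the factorials, and what remains is the convolution for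
  \<open>(g/u)\<^sup>n (u/g)\<^sup>n = 1\<close>.\<close>

lemma fps_factor_X:
  fixes f :: "'a::comm_ring_1 fps"
  assumes "f $ 0 = 0"
  shows "f = fps_X * fps_shift 1 f"
  using assms by (simp add: fps_eq_iff)

lemma fps_deriv_power_Suc:
  fixes a :: "'a::comm_semiring_1 fps"
  shows "fps_deriv (a ^ Suc n) = fps_const (of_nat (Suc n)) * (a ^ n * fps_deriv a)"
  unfolding fps_deriv_power by (simp add: ac_simps)

text \<open>As \<open>f\<close> has no constant term, \<open>f ^ i\<close> has no coefficients below
  \<open>i\<close>. All the inner sums can therefore run up to the same \<open>n\<close> and be
  swapped.\<close>

lemma fps_compose_mult_nth:
  fixes a b f :: "'a::comm_ring_1 fps"
  assumes "f $ 0 = 0"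
  shows "((a oo f) * b) $ n = (\<Sum>i=0..n. a $ i * (f ^ i * b) $ n)"
proof -
  have "(a oo f) $ j = (\<Sum>i=0..n. a $ i * (f ^ i $ j))" if "j \<le> n" for j
    unfolding fps_compose_nth using that startsby_zero_power_prefix[OF assms]
    by (intro sum.mono_neutral_left) auto
  then have "((a oo f) * b) $ n = (\<Sum>j=0..n. (\<Sum>i=0..n. a $ i * (f ^ i $ j)) * b $ (n - j))"
    by (simp add: fps_mult_nth)
  also have "\<dots> = (\<Sum>i=0..n. \<Sum>j=0..n. a $ i * (f ^ i $ j) * b $ (n - j))"
    by (simp add: sum_distrib_right, rule sum.swap)
  finally show ?thesis
    by (simp add: fps_mult_nth sum_distrib_left mult.assoc)
qed

text \<open>With \<open>V = t/f\<close>, the coefficient below is the residue of \<open>f'/f\<^bsup>m+1\<^esup>\<close>; this form avoids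
  Laurent series.\<close>

lemma fps_residue_power:
  fixes f V :: "'a::field_char_0 fps"
  assumes fV: "f * V = fps_X" and f0: "f $ 0 = 0"
  shows "(V ^ Suc m * fps_deriv f) $ m = (if m = 0 then 1 else 0)"
proof -
  have "f * fps_deriv V + fps_deriv f * V = 1"
    using arg_cong[OF fV, of fps_deriv] by simp
  then have d: "V * fps_deriv f = 1 - f * fps_deriv V"
    by (simp add: algebra_simps)
  show ?thesis
  proof (cases m)
    case 0
    have "f $ 1 * V $ 0 = 1"
      using arg_cong[OF fV, of "\<lambda>h. h $ 1"] f0 by simp
    then show ?thesis
      by (simp add: 0 mult.commute)
  next
    case (Suc l)
    have "V ^ Suc m * fps_deriv f = V ^ m * (V * fps_deriv f)"
      by (simp add: algebra_simps)
    also have "\<dots> = V ^ m - V ^ l * (f * V) * fps_deriv V"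
      unfolding d by (simp add: Suc algebra_simps)
    finally have "V ^ Suc m * fps_deriv f = V ^ m - fps_X * (V ^ l * fps_deriv V)"
      unfolding fV by (simp only: ac_simps)
    \<comment> \<open>\<open>V ^ l * fps_deriv V\<close> is the derivative of \<open>V ^ m\<close>
      divided by \<open>m\<close>, so its coefficient at \<open>l\<close> is that of
      \<open>V ^ m\<close> at \<open>m\<close>: the two terms above cancel.\<close>
    moreover have "of_nat (Suc l) * (V ^ l * fps_deriv V) $ l = of_nat (Suc l) * (V ^ m) $ m"
      using arg_cong[OF fps_deriv_power_Suc[of V l], of "\<lambda>h. h $ l"]
      by (simp only: Suc fps_deriv_nth fps_mult_left_const_nth Suc_eq_plus1)
    then have "(V ^ l * fps_deriv V) $ l = (V ^ m) $ m"
      by (simp only: mult_cancel_left of_nat_eq_0_iff) simp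
    ultimately show ?thesis
      by (simp add: Suc del: power_Suc)
  qed
qed

text \<open>For \<open>i \<le> n\<close>, \<open>i\<close> factors \<open>V\<close> turn
  \<open>f ^ i\<close> into \<open>fps_X ^ i\<close>, leaving the residue for \<open>n - i\<close>.
  For \<open>i > n\<close>, \<open>fps_X ^ i\<close> divides the product.\<close>

lemma fps_residue:
  fixes f V :: "'a::field_char_0 fps"
  assumes fV: "f * V = fps_X" and f0: "f $ 0 = 0"
  shows "(f ^ i * (V ^ Suc n * fps_deriv f)) $ n = (if i = n then 1 else 0)"
proof (cases "i \<le> n")
  case True
  then have "V ^ Suc n = V ^ i * V ^ Suc (n - i)"
    by (simp flip: power_add)
  then have "f ^ i * (V ^ Suc n * fps_deriv f) = (f * V) ^ i * (V ^ Suc (n - i) * fps_deriv f)"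
    by (simp only: power_mult_distrib ac_simps)
  then show ?thesis
    using True fps_residue_power[OF fV f0, of "n - i"]
    by (simp only: fV fps_X_power_mult_nth) auto
next
  case False
  have "f ^ i = fps_X ^ i * fps_shift 1 f ^ i"
    by (subst fps_factor_X[OF f0]) (simp add: power_mult_distrib)
  with False show ?thesis
    by (simp add: mult.assoc fps_X_power_mult_nth)
qed

text \<open>Differentiate \<open>g ^ p oo f = fps_X ^ p\<close>, multiply by \<open>V ^ N\<close>
  and compare coefficients at \<open>N - 1\<close>: on the left, \<open>fps_residue\<close> isolates
  one coefficient of the derivative of \<open>g ^ p\<close>. The bound on \<open>p\<close> keeps
  \<open>N - p\<close> from being truncated.\<close>

theorem fps_Lagrange_inversion:
  fixes f g V :: "'a::field_char_0 fps"
  assumes fV: "f * V = fps_X" and f0: "f $ 0 = 0" and gf: "g oo f = fps_X" and "p \<le> N"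
  shows "of_nat N * (g ^ p) $ N = of_nat p * (V ^ N) $ (N - p)"
proof (cases N)
  case 0
  with \<open>p \<le> N\<close> show ?thesis by simp
next
  case (Suc n)
  have "(fps_deriv (g ^ p) oo f) * (V ^ N * fps_deriv f) = fps_deriv (g ^ p oo f) * V ^ N"
    by (simp add: fps_compose_deriv[OF f0] algebra_simps)
  also have "\<dots> = fps_deriv (fps_X ^ p) * V ^ N"
    by (simp add: gf flip: fps_compose_power[OF f0])
  finally have eq: "(fps_deriv (g ^ p) oo f) * (V ^ N * fps_deriv f) = fps_deriv (fps_X ^ p) * V ^ N" .
  have "((fps_deriv (g ^ p) oo f) * (V ^ N * fps_deriv f)) $ n
      = (\<Sum>i=0..n. fps_deriv (g ^ p) $ i * (if i = n then 1 else 0))"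
    unfolding fps_compose_mult_nth[OF f0] Suc fps_residue[OF fV f0] ..
  also have "\<dots> = of_nat N * (g ^ p) $ N"
    by (simp add: Suc if_distrib cong: if_cong)
  finally have l: "of_nat N * (g ^ p) $ N = (fps_deriv (fps_X ^ p) * V ^ N) $ n"
    by (simp add: eq)
  show ?thesis
  proof (cases p)
    case 0
    then show ?thesis using l by simp
  next
    case (Suc q)
    have d: "fps_deriv (fps_X ^ p) * V ^ N = fps_const (of_nat p) * (fps_X ^ q * V ^ N)"
      unfolding Suc fps_deriv_power_Suc by (simp add: mult.assoc)
    show ?thesis
      unfolding l d using \<open>p \<le> N\<close> by (simp add: \<open>N = Suc n\<close> Suc fps_X_power_mult_nth del: power_Suc)
  qed
qed

text \<open>The derivative of \<open>fps_exp 1 - 1\<close> is itself plus 1, so differentiating its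
  powers reproduces the Stirling recurrence.\<close>

lemma Stirling_egf:
  "(fps_exp 1 - 1 :: 'a::field_char_0 fps) ^ j $ n = fact j / fact n * of_nat (Stirling n j)"
proof (induction n arbitrary: j)
  case 0
  show ?case by (cases j) simp_all
next
  case (Suc n)
  show ?case
  proof (cases j)
    case 0
    then show ?thesis by simp
  next
    case (Suc i)
    let ?E = "fps_exp 1 - 1 :: 'a fps"
    have "fps_deriv (?E ^ j) = fps_const (of_nat j) * (?E ^ j + ?E ^ i)"
      unfolding Suc fps_deriv_power_Suc by (simp add: algebra_simps)
    then have "of_nat (Suc n) * (?E ^ j) $ Suc n = of_nat j * ((?E ^ j) $ n + (?E ^ i) $ n)"
      by (metis fps_deriv_nth fps_mult_left_const_nth fps_add_nth Suc_eq_plus1)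
    also have "\<dots> = fact j / fact n * of_nat (Stirling (Suc n) j)"
      unfolding Suc.IH by (simp add: Suc field_simps)
    finally show ?thesis
      by (simp add: field_simps del: of_nat_Suc Stirling.simps)
  qed
qed

theorem theorem5:
  fixes n m :: nat
  assumes "n \<ge> 1" and "1 \<le> m" and "m \<le> n"
  shows "(\<Sum>k = 0..n - m.
            (of_nat n * of_nat ((k + m - 1) choose k) / of_nat (n + k) :: rat)
              * bernoulli_order (n + k) k * of_nat (Stirling n (k + m)))
         = (if m = n then 1 else 0)"
proof -
  define f :: "rat fps" where "f = fps_exp 1 - 1"
  define V :: "rat fps" where "V = fps_X / (fps_exp 1 - 1)"
  define g where "g = fps_inv f"
  define G where "G = fps_shift 1 g"
  define W where "W = inverse G"
  have f0: "f $ 0 = 0" and f1: "f $ 1 \<noteq> 0" and fV: "f * V = fps_X"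
    using bernoulli_base_mult by (simp_all add: f_def V_def mult.commute)
  have g0: "g $ 0 = 0" and "g $ 1 \<noteq> 0"
    using f1 by (simp_all add: g_def fps_inv_def)
  then have "G * W = 1"
    by (simp add: G_def W_def inverse_mult_eq_1')
  have gX: "g = fps_X * G"
    unfolding G_def by (rule fps_factor_X[OF g0])
  have gW: "g * W = fps_X"
    by (simp add: gX mult.assoc \<open>G * W = 1\<close>)
  have gf: "g oo f = fps_X" and fg: "f oo g = fps_X"
    unfolding g_def using fps_inv[OF f0 f1] fps_inv_right[OF f0 f1] by simp_all
  have "of_nat n * of_nat ((k + m - 1) choose k) / of_nat (n + k)
          * bernoulli_order (n + k) k * of_nat (Stirling n (k + m))
        = fact (n - 1) / fact (m - 1) * ((G ^ n) $ k * (W ^ n) $ (n - m - k))"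
    if "k \<in> {0..n - m}" for k
  proof -
    have k: "k + m \<le> n" using that assms by auto
    have "(g ^ n) $ (n + k) = (G ^ n) $ k"
      by (simp add: gX power_mult_distrib fps_X_power_mult_nth)
    moreover have "of_nat (n + k) * (g ^ n) $ (n + k) = of_nat n * (V ^ (n + k)) $ k"
      using fps_Lagrange_inversion[OF fV f0 gf, of n "n + k"] by simp
    ultimately have B: "of_nat n / of_nat (n + k) * bernoulli_order (n + k) k = fact k * (G ^ n) $ k"
      using assms by (simp add: bernoulli_order_def V_def field_simps)
    \<comment> \<open>Exchanged roles: \<open>f\<close> is the inverse of \<open>g\<close>, and
      \<open>W\<close> is the cofactor of \<open>g\<close>.\<close>
    have "of_nat n * (f ^ (k + m)) $ n = of_nat (k + m) * (W ^ n) $ (n - m - k)"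
      using fps_Lagrange_inversion[OF gW g0 fg k] by (simp add: add.commute)
    then have "of_nat n * (fact (k + m) / fact n * of_nat (Stirling n (k + m)))
        = of_nat (k + m) * (W ^ n) $ (n - m - k)"
      by (simp add: f_def Stirling_egf)
    moreover have "(fact n :: rat) = of_nat n * fact (n - 1)"
      "(fact (k + m) :: rat) = of_nat (k + m) * fact (k + m - 1)"
      using assms by (simp_all add: fact_reduce)
    ultimately have S: "of_nat (Stirling n (k + m))
        = fact (n - 1) / fact (k + m - 1) * (W ^ n) $ (n - m - k)"
      using assms by (simp add: field_simps del: of_nat_add)
    have C: "of_nat ((k + m - 1) choose k) = (fact (k + m - 1) / (fact k * fact (m - 1)) :: rat)"
      using assms by (subst binomial_fact) simp_all
    have "of_nat n * of_nat ((k + m - 1) choose k) / of_nat (n + k)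
          * bernoulli_order (n + k) k * of_nat (Stirling n (k + m))
        = of_nat n / of_nat (n + k) * bernoulli_order (n + k) k
          * of_nat ((k + m - 1) choose k) * of_nat (Stirling n (k + m))"
      by simp
    \<comment> \<open>\<open>fact k\<close> and \<open>fact (k + m - 1)\<close> cancel, leaving a
      factor independent of \<open>k\<close>.\<close>
    then show ?thesis
      unfolding B S C by simp
  qed
  then have "(\<Sum>k = 0..n - m. of_nat n * of_nat ((k + m - 1) choose k) / of_nat (n + k)
          * bernoulli_order (n + k) k * of_nat (Stirling n (k + m)))
      = fact (n - 1) / fact (m - 1) * (G ^ n * W ^ n) $ (n - m)"
    by (simp add: fps_mult_nth sum_distrib_left)
  also have "G ^ n * W ^ n = 1"
    by (simp add: \<open>G * W = 1\<close> flip: power_mult_distrib)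
  \<comment> \<open>For \<open>m = n\<close> the factorial quotient is 1.\<close>
  finally show ?thesis
    using assms by auto
qed

end
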